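(* Consider an MDP-JLS with ergodic unichain MDP $\mathcal{M}=(S,\hat{s},\Sigma,T)$ and mode matrices $A_s\in\mathbb{R}^{n\times n}$, $s\in S$. Let $0<\alpha<1$ and $\mu>1$ be constants, and assume there exists a Lyapunov function candidate $V=\{V_s : s\in S\}$, $V_s:\mathbb{R}^n\to\mathbb{R}$, such that for every pair $s,s'\in S$ and every $x\in\mathbb{R}^n$, $$V_s(A_sx)-V_s(x)\le-\alpha V_s(x),\qquad V_s(x)\le\mu V_{s'}(x).$$ Let $\pi$ be a policy whose induced DTMC, with transition matrix $P$, has a stationary distribution $p^\infty$. If $$P_{jump}:=1-\sum_{s\in S}p^\infty_sP(s,s)<\frac{\ln\left(\frac{1}{1-\alpha}\right)}{\ln(\mu)},$$ then the MJLS induced by $\pi$ is stable with probability one.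
   Context: An MDP is a tuple $\mathcal{M}=(S,\hat{s},\Sigma,T)$ with finite state set $S$, initial state $\hat s\in S$, finite action set $\Sigma$, and transition function $T(s,\sigma,s')=p(s'|s,\sigma)$. If $\sigma$ is available at $s$ then $T(s,\sigma,\cdot)$ is a probability distribution; otherwise $T(s,\sigma,\cdot)=0$ and policies do not select $\sigma$ at $s$. A policy $\pi:S\times\Sigma\to[0,1]$ gives the probability $\pi(s,\sigma)$ of taking action $\sigma$ at $s$. Under $\pi$ the MDP reduces to a discrete-time Markov chain (DTMC) $(S,\hat s,P)$ with $P(s,s')=\sum_{\sigma}T(s,\sigma,s')\pi(s,\sigma)$. A DTMC is an ergodic unichain if it has a single ergodic class (communicating class of recurrent aperiodic states) and possibly some transient states; an MDP is an ergodic unichain if every policy induces an ergodic unichain DTMC (so the stationary distribution exists and is unique). An MDP-JLS is the switched system $x(k+1)=A_{s_k}x(k)$, $x(k)\in\mathbb{R}^n$, where $s_k\in S$ is the mode at time $k$, with the mode process governed by $\mathcal{M}$. Given a policy it becomes a Markov jump linear system (MJLS): the modes follow the induced DTMC. An MJLS is stable with probability one if, for any initial condition $x_0$, $\lim_{k\to\infty}\|x(k)\|_\infty=0$ with probability one. Lyapunov function candidate: each $V_s$ is continuous, radially unbounded, $V_s(0)=0$ and $V_s(x)>0$ for $x\ne0$. *)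

theory Defs
  imports "HOL-Probability.Probability"
begin

section \<open>Finite Markov chains\<close>

text \<open>
  A finite state set is modelled by a type of class \<open>finite\<close>, a transition matrix by a
  function \<open>P\<close> with \<open>P i j\<close> the probability of moving from \<open>i\<close> to \<open>j\<close>.
\<close>

primrec nstep :: "('s::finite \<Rightarrow> 's \<Rightarrow> real) \<Rightarrow> nat \<Rightarrow> 's \<Rightarrow> 's \<Rightarrow> real" where
  "nstep P 0 i j = (if i = j then 1 else 0)"
| "nstep P (Suc n) i j = (\<Sum>k\<in>UNIV. P i k * nstep P n k j)"

definition accessible :: "('s::finite \<Rightarrow> 's \<Rightarrow> real) \<Rightarrow> 's \<Rightarrow> 's \<Rightarrow> bool" where
  "accessible P i j \<longleftrightarrow> (\<exists>n. nstep P n i j > 0)"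

definition communicating_class :: "('s::finite \<Rightarrow> 's \<Rightarrow> real) \<Rightarrow> 's set \<Rightarrow> bool" where
  "communicating_class P C \<longleftrightarrow> (\<exists>i. C = {j. accessible P i j \<and> accessible P j i})"

text \<open>
  \<open>first_passage P n i j\<close> is the probability that the chain started in \<open>i\<close> visits \<open>j\<close> at
  time \<open>n + 1\<close> and at none of the times \<open>1, \<dots>, n\<close>.
\<close>

primrec first_passage :: "('s::finite \<Rightarrow> 's \<Rightarrow> real) \<Rightarrow> nat \<Rightarrow> 's \<Rightarrow> 's \<Rightarrow> real" where
  "first_passage P 0 i j = P i j"
| "first_passage P (Suc n) i j = (\<Sum>k\<in>UNIV - {j}. P i k * first_passage P n k j)"

definition recurrent :: "('s::finite \<Rightarrow> 's \<Rightarrow> real) \<Rightarrow> 's \<Rightarrow> bool" where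
  "recurrent P i \<longleftrightarrow> (\<lambda>n. first_passage P n i i) sums 1"

definition transient :: "('s::finite \<Rightarrow> 's \<Rightarrow> real) \<Rightarrow> 's \<Rightarrow> bool" where
  "transient P i \<longleftrightarrow> \<not> recurrent P i"

definition period :: "('s::finite \<Rightarrow> 's \<Rightarrow> real) \<Rightarrow> 's \<Rightarrow> nat" where
  "period P i = Gcd {n. n > 0 \<and> nstep P n i i > 0}"

definition aperiodic :: "('s::finite \<Rightarrow> 's \<Rightarrow> real) \<Rightarrow> 's \<Rightarrow> bool" where
  "aperiodic P i \<longleftrightarrow> period P i = 1"

definition ergodic_class :: "('s::finite \<Rightarrow> 's \<Rightarrow> real) \<Rightarrow> 's set \<Rightarrow> bool" where
  "ergodic_class P C \<longleftrightarrow>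
     communicating_class P C \<and> (\<forall>i\<in>C. recurrent P i \<and> aperiodic P i)"

definition ergodic_unichain :: "('s::finite \<Rightarrow> 's \<Rightarrow> real) \<Rightarrow> bool" where
  "ergodic_unichain P \<longleftrightarrow>
     (\<exists>C. ergodic_class P C \<and> (\<forall>i. i \<notin> C \<longrightarrow> transient P i))"

definition stationary_distribution ::
    "('s::finite \<Rightarrow> 's \<Rightarrow> real) \<Rightarrow> ('s \<Rightarrow> real) \<Rightarrow> bool" where
  "stationary_distribution P p \<longleftrightarrow>
     (\<forall>i. p i \<ge> 0) \<and> (\<Sum>i\<in>UNIV. p i) = 1 \<and> (\<forall>j. (\<Sum>i\<in>UNIV. p i * P i j) = p j)"

text \<open>
  The process \<open>X\<close> on the probability space \<open>W\<close> is a Markov chain with initial state \<open>s0\<close>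
  and transition matrix \<open>P\<close>.
\<close>

definition markov_chain ::
    "'w measure \<Rightarrow> (nat \<Rightarrow> 'w \<Rightarrow> 's::finite) \<Rightarrow> 's \<Rightarrow> ('s \<Rightarrow> 's \<Rightarrow> real) \<Rightarrow> bool" where
  "markov_chain W X s0 P \<longleftrightarrow>
     prob_space W \<and>
     (\<forall>k. X k \<in> measurable W (count_space UNIV)) \<and>
     (AE w in W. X 0 w = s0) \<and>
     (\<forall>n (i :: nat \<Rightarrow> 's) j. \<P>(w in W. \<forall>k\<le>n. X k w = i k) > 0 \<longrightarrow>
        \<P>(w in W. X (Suc n) w = j \<bar> \<forall>k\<le>n. X k w = i k) = P (i n) j)"


section \<open>Markov decision processes\<close>

text \<open>
  The state set and the action set are the (finite) types \<open>'s\<close> and \<open>'a\<close>. Since the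
  transition function vanishes exactly at unavailable actions, availability is read off
  from it.
\<close>

record ('s, 'a) mdp =
  init :: 's
  trans :: "'s \<Rightarrow> 'a \<Rightarrow> 's \<Rightarrow> real"

definition available :: "('s::finite, 'a::finite) mdp \<Rightarrow> 's \<Rightarrow> 'a \<Rightarrow> bool" where
  "available M s a \<longleftrightarrow> (\<exists>s'. trans M s a s' \<noteq> 0)"

definition is_mdp :: "('s::finite, 'a::finite) mdp \<Rightarrow> bool" where
  "is_mdp M \<longleftrightarrow> (\<forall>s a. available M s a \<longrightarrow>
     (\<forall>s'. trans M s a s' \<ge> 0) \<and> (\<Sum>s'\<in>UNIV. trans M s a s') = 1)"

definition is_policy :: "('s::finite, 'a::finite) mdp \<Rightarrow> ('s \<Rightarrow> 'a \<Rightarrow> real) \<Rightarrow> bool" where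
  "is_policy M \<pi> \<longleftrightarrow>
     (\<forall>s. (\<forall>a. \<pi> s a \<ge> 0) \<and> (\<Sum>a\<in>UNIV. \<pi> s a) = 1 \<and>
          (\<forall>a. \<not> available M s a \<longrightarrow> \<pi> s a = 0))"

definition induced :: "('s::finite, 'a::finite) mdp \<Rightarrow> ('s \<Rightarrow> 'a \<Rightarrow> real) \<Rightarrow> 's \<Rightarrow> 's \<Rightarrow> real" where
  "induced M \<pi> s s' = (\<Sum>a\<in>UNIV. trans M s a s' * \<pi> s a)"

definition ergodic_unichain_mdp :: "('s::finite, 'a::finite) mdp \<Rightarrow> bool" where
  "ergodic_unichain_mdp M \<longleftrightarrow>
     is_mdp M \<and> (\<forall>\<pi>. is_policy M \<pi> \<longrightarrow> ergodic_unichain (induced M \<pi>))"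


section \<open>Jump linear systems\<close>

primrec trajectory ::
    "('s \<Rightarrow> real^'n^'n) \<Rightarrow> (nat \<Rightarrow> 's) \<Rightarrow> real^'n \<Rightarrow> nat \<Rightarrow> real^'n" where
  "trajectory A s x0 0 = x0"
| "trajectory A s x0 (Suc k) = A (s k) *v trajectory A s x0 k"

text \<open>The mode process is \<open>X\<close>; \<^const>\<open>infnorm\<close> is the maximum norm.\<close>

definition stable_with_probability_one ::
    "'w measure \<Rightarrow> (nat \<Rightarrow> 'w \<Rightarrow> 's) \<Rightarrow> ('s \<Rightarrow> real^'n^'n) \<Rightarrow> bool" where
  "stable_with_probability_one W X A \<longleftrightarrow>
     (\<forall>x0. AE w in W. (\<lambda>k. infnorm (trajectory A (\<lambda>j. X j w) x0 k)) \<longlonglongrightarrow> 0)"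

definition lyapunov_candidate :: "('s \<Rightarrow> real^'n \<Rightarrow> real) \<Rightarrow> bool" where
  "lyapunov_candidate V \<longleftrightarrow>
     (\<forall>s. continuous_on UNIV (V s) \<and> filterlim (V s) at_top at_infinity \<and>
          V s 0 = 0 \<and> (\<forall>x. x \<noteq> 0 \<longrightarrow> V s x > 0))"

definition jump_probability :: "('s::finite \<Rightarrow> 's \<Rightarrow> real) \<Rightarrow> ('s \<Rightarrow> real) \<Rightarrow> real" where
  "jump_probability P p = 1 - (\<Sum>s\<in>UNIV. p s * P s s)"

end

theory Submission imports Defs begin

text \<open>
  Along a trajectory the Lyapunov value is multiplied by at most \<open>(1 - \<alpha>)\<close> per step and by a further
  \<open>\<mu>\<close> per jump, i.e. by \<open>exp (c i j)\<close> for a transition from \<open>i\<close> to \<open>j\<close>, and the hypothesis on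
  \<open>P_jump\<close> says that the stationary mean of \<open>c\<close> is negative. Instead of appealing to the ergodic theorem,
  one solves a strict Poisson inequality for a function \<open>h\<close> that makes every conditional mean of
  \<open>c i j + h j - h i\<close> negative. For small \<open>\<theta> > 0\<close> the expectation of
  \<open>exp (\<theta> * (c-sum up to n + h (X n)))\<close> then decays geometrically, so its values are almost surely
  summable and tend to \<open>0\<close>.
\<close>

section \<open>Stochasticity of the matrices induced by policies\<close>

definition stochastic :: "('s::finite \<Rightarrow> 's \<Rightarrow> real) \<Rightarrow> bool" where
  "stochastic P \<longleftrightarrow> (\<forall>i j. P i j \<ge> 0) \<and> (\<forall>i. (\<Sum>j\<in>UNIV. P i j) = 1)"

lemma stochastic_induced:
  assumes "is_mdp M" "is_policy M \<pi>"
  shows "stochastic (induced M \<pi>)"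
proof -
  have 0: "trans M s a s' * \<pi> s a \<ge> 0" for s a s'
    using assms unfolding is_mdp_def is_policy_def
    by (cases "available M s a") auto
  have 1: "(\<Sum>s'\<in>UNIV. trans M s a s' * \<pi> s a) = \<pi> s a" for s a
    using assms unfolding is_mdp_def is_policy_def
    by (cases "available M s a") (auto simp flip: sum_distrib_right)
  have "(\<Sum>s'\<in>UNIV. induced M \<pi> s s') = 1" for s
  proof -
    have "(\<Sum>s'\<in>UNIV. induced M \<pi> s s') = (\<Sum>a\<in>UNIV. \<Sum>s'\<in>UNIV. trans M s a s' * \<pi> s a)"
      unfolding induced_def by (rule sum.swap)
    also have "\<dots> = 1"
      using assms(2) by (simp add: 1 is_policy_def)
    finally show ?thesis .
  qed
  moreover have "induced M \<pi> s s' \<ge> 0" for s s'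
    unfolding induced_def by (intro sum_nonneg 0)
  ultimately show ?thesis
    unfolding stochastic_def by blast
qed

section \<open>Uniqueness of the stationary distribution\<close>

text \<open>The total mass is left free, so that the positive and negative parts of a difference of
  stationary distributions qualify.\<close>

definition invariant_measure :: "('s::finite \<Rightarrow> 's \<Rightarrow> real) \<Rightarrow> ('s \<Rightarrow> real) \<Rightarrow> bool" where
  "invariant_measure P q \<longleftrightarrow> (\<forall>i. q i \<ge> 0) \<and> (\<forall>j. (\<Sum>i\<in>UNIV. q i * P i j) = q j)"

text \<open>For stochastic \<open>P\<close>, the probability that the chain started in
  \<open>j\<close> is away from \<open>i\<close> at times 1 to \<open>n\<close>. Time 0 is not
  tested, so \<open>j = i\<close> gives the tail of the return time.\<close>

primrec avoidance :: "('s::finite \<Rightarrow> 's \<Rightarrow> real) \<Rightarrow> 's \<Rightarrow> nat \<Rightarrow> 's \<Rightarrow> real" where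
  "avoidance P i 0 j = 1"
| "avoidance P i (Suc n) j = (\<Sum>k\<in>UNIV - {i}. P j k * avoidance P i n k)"

lemma avoidance_nonneg: "stochastic P \<Longrightarrow> avoidance P i n j \<ge> 0"
  by (induction n arbitrary: j) (auto simp: stochastic_def intro!: sum_nonneg)

text \<open>Reaching \<open>i\<close> by time \<open>n\<close> and avoiding it until then are
  complementary; the induction conditions on the first step. Recurrence of \<open>i\<close> thus
  becomes \<open>avoidance P i n i\<close> tending to 0.\<close>

lemma first_passage_partial_sum:
  assumes "stochastic P"
  shows "(\<Sum>m<n. first_passage P m j i) = 1 - avoidance P i n j"
proof (induction n arbitrary: j)
  case (Suc n)
  have "(\<Sum>m<Suc n. first_passage P m j i)
      = P j i + (\<Sum>m<n. \<Sum>k\<in>UNIV - {i}. P j k * first_passage P m k i)"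
    by (simp add: sum.lessThan_Suc_shift del: sum.lessThan_Suc)
  also have "\<dots> = P j i + (\<Sum>k\<in>UNIV - {i}. P j k * (\<Sum>m<n. first_passage P m k i))"
    by (subst sum.swap) (simp add: sum_distrib_left)
  also have "\<dots> = P j i + (\<Sum>k\<in>UNIV - {i}. P j k) - avoidance P i (Suc n) j"
    by (simp add: Suc algebra_simps sum_subtractf)
  also have "P j i + (\<Sum>k\<in>UNIV - {i}. P j k) = 1"
    using assms sum.remove[of UNIV i "P j"] by (simp add: stochastic_def)
  finally show ?case .
qed simp

text \<open>The argument behind Kac's formula: the mean return time to \<open>i\<close> is at most
  \<open>(\<Sum>j. q j) / q i\<close>, so the return time is almost surely finite.\<close>

lemma invariant_measure_pos_recurrent:
  assumes P: "stochastic P" and q: "invariant_measure P q" and "q i > 0"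
  shows "recurrent P i"
proof -
  let ?u = "avoidance P i"
  \<comment> \<open>Invariance turns \<open>q j * P j k\<close>, summed over \<open>j\<close>, into
    \<open>q k\<close>; only the excluded term \<open>k = i\<close> is lost, so the sums of these
    losses telescope.\<close>
  have step: "(\<Sum>j\<in>UNIV. q j * ?u (Suc n) j) = (\<Sum>j\<in>UNIV. q j * ?u n j) - q i * ?u n i" for n
  proof -
    have "(\<Sum>j\<in>UNIV. q j * ?u (Suc n) j)
        = (\<Sum>k\<in>UNIV - {i}. \<Sum>j\<in>UNIV. q j * (P j k * ?u n k))"
      by (simp add: sum_distrib_left) (rule sum.swap)
    also have "\<dots> = (\<Sum>k\<in>UNIV - {i}. (\<Sum>j\<in>UNIV. q j * P j k) * ?u n k)"
      by (simp add: sum_distrib_right mult.assoc)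
    also have "\<dots> = (\<Sum>k\<in>UNIV - {i}. q k * ?u n k)"
      using q by (simp add: invariant_measure_def)
    also have "\<dots> = (\<Sum>j\<in>UNIV. q j * ?u n j) - q i * ?u n i"
      by (simp add: sum_diff1)
    finally show ?thesis .
  qed
  have eq: "(\<Sum>m<n. q i * ?u m i) = (\<Sum>j\<in>UNIV. q j) - (\<Sum>j\<in>UNIV. q j * ?u n j)" for n
    by (induction n) (simp_all only: step, simp_all)
  have "(\<Sum>m<n. q i * ?u m i) \<le> (\<Sum>j\<in>UNIV. q j)" for n
    unfolding eq using q avoidance_nonneg[OF P]
    by (simp add: invariant_measure_def sum_nonneg)
  then have "summable (\<lambda>m. q i * ?u m i)"
    using q avoidance_nonneg[OF P]
    by (intro summableI_nonneg_bounded) (auto simp: invariant_measure_def)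
  then have "summable (\<lambda>m. ?u m i)"
    using \<open>q i > 0\<close> by simp
  then have "(\<lambda>n. 1 - ?u n i) \<longlonglongrightarrow> 1 - 0"
    by (intro tendsto_diff tendsto_const summable_LIMSEQ_zero)
  then show ?thesis
    by (simp add: recurrent_def sums_def first_passage_partial_sum[OF P])
qed

text \<open>Invariance gives \<open>q k \<ge> q i * P i k\<close>, so positive mass spreads along
  every path of positive probability.\<close>

lemma invariant_measure_accessible:
  assumes P: "stochastic P" and q: "invariant_measure P q"
    and "q i > 0" "accessible P i j"
  shows "q j > 0"
proof -
  have "q j > 0" if "nstep P n i j > 0" "q i > 0" for n
    using that
  proof (induction n arbitrary: i)
    case 0
    then show ?case by (simp split: if_splits)
  next
    case (Suc n)
    have "\<not> (\<forall>k. P i k * nstep P n k j \<le> 0)"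
      using Suc.prems(1) sum_nonpos[of UNIV "\<lambda>k. P i k * nstep P n k j"] by auto
    then obtain k where "P i k * nstep P n k j > 0"
      by (auto simp: not_le)
    moreover have "P i k \<ge> 0"
      using P by (simp add: stochastic_def)
    ultimately have k: "P i k > 0" "nstep P n k j > 0"
      by (auto simp: zero_less_mult_iff)
    have "0 < q i * P i k"
      using k Suc.prems by simp
    also have "\<dots> \<le> (\<Sum>i\<in>UNIV. q i * P i k)"
      using P q by (intro member_le_sum) (auto simp: stochastic_def invariant_measure_def)
    also have "\<dots> = q k"
      using q by (simp add: invariant_measure_def)
    finally show ?case
      using Suc.IH k by blast
  qed
  then show ?thesis
    using assms by (auto simp: accessible_def)
qed

text \<open>The positive and negative parts of \<open>p - q\<close> are both invariant. A nonzero
  invariant measure charges a recurrent state, hence every state of the single ergodic class; two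
  measures with disjoint supports cannot both do so.\<close>

lemma ergodic_unichain_stationary_unique:
  assumes P: "stochastic P" "ergodic_unichain P"
    and p: "stationary_distribution P p" and q: "stationary_distribution P q"
  shows "p = q"
proof -
  define d where "d i = p i - q i" for i
  have dP: "(\<Sum>i\<in>UNIV. d i * P i j) = d j" for j
    using p q by (simp add: d_def stationary_distribution_def algebra_simps sum_subtractf)
  have d0: "(\<Sum>i\<in>UNIV. d i) = 0"
    using p q by (simp add: d_def stationary_distribution_def sum_subtractf)
  have le: "\<bar>d j\<bar> \<le> (\<Sum>i\<in>UNIV. \<bar>d i\<bar> * P i j)" for j
  proof -
    have "\<bar>d j\<bar> \<le> (\<Sum>i\<in>UNIV. \<bar>d i * P i j\<bar>)"
      by (subst dP[symmetric]) (rule sum_abs)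
    then show ?thesis
      using P by (simp add: abs_mult stochastic_def)
  qed
  \<comment> \<open>Rows sum to 1, so both sides of \<open>le\<close> have the same total over
    \<open>j\<close>; the nonnegative gaps must all vanish.\<close>
  have "(\<Sum>j\<in>UNIV. \<Sum>i\<in>UNIV. \<bar>d i\<bar> * P i j) = (\<Sum>i\<in>UNIV. \<bar>d i\<bar> * (\<Sum>j\<in>UNIV. P i j))"
    by (subst sum.swap) (simp add: sum_distrib_left)
  then have "(\<Sum>j\<in>UNIV. (\<Sum>i\<in>UNIV. \<bar>d i\<bar> * P i j) - \<bar>d j\<bar>) = 0"
    using P by (simp add: sum_subtractf stochastic_def)
  then have abs_eq: "(\<Sum>i\<in>UNIV. \<bar>d i\<bar> * P i j) = \<bar>d j\<bar>" for j
    using le by (subst (asm) sum_nonneg_eq_0_iff) auto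
  have inv: "invariant_measure P (\<lambda>i. (\<bar>d i\<bar> + d i) / 2)"
            "invariant_measure P (\<lambda>i. (\<bar>d i\<bar> - d i) / 2)"
    unfolding invariant_measure_def
    by (auto simp: add_divide_distrib diff_divide_distrib distrib_right left_diff_distrib
          sum.distrib sum_subtractf abs_eq dP simp flip: sum_divide_distrib)
  obtain C where C: "ergodic_class P C" "\<And>i. i \<notin> C \<Longrightarrow> transient P i"
    using P by (auto simp: ergodic_unichain_def)
  obtain c where c: "C = {j. accessible P c j \<and> accessible P j c}"
    using C by (auto simp: ergodic_class_def communicating_class_def)
  have reach: "r c > 0" if "invariant_measure P r" "r i > 0" for r i
  proof -
    have "recurrent P i"
      using P that by (auto intro: invariant_measure_pos_recurrent)
    then have "i \<in> C"
      using C by (auto simp: transient_def)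
    then show ?thesis
      using invariant_measure_accessible P that c by blast
  qed
  have "d i = 0" for i
  proof (rule ccontr)
    assume "d i \<noteq> 0"
    \<comment> \<open>A nonzero \<open>d\<close> with total 0 takes both signs, so both parts are
      nonzero and both charge \<open>c\<close>.\<close>
    have "\<not> (\<forall>j. d j \<le> 0)"
      using d0 \<open>d i \<noteq> 0\<close> sum_nonneg_eq_0_iff[of UNIV "\<lambda>j. - d j"] by (auto simp: sum_negf)
    moreover have "\<not> (\<forall>j. d j \<ge> 0)"
    proof
      assume *: "\<forall>j. d j \<ge> 0"
      have "d i > 0"
        using * \<open>d i \<noteq> 0\<close> by (simp add: order_less_le)
      then have "(\<Sum>i\<in>UNIV. d i) > 0"
        using * by (intro sum_pos2[of _ i]) simp_all
      with d0 show False by simp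
    qed
    ultimately obtain j k where "d j > 0" "d k < 0"
      by (auto simp: not_le)
    then show False
      using reach[OF inv(1), of j] reach[OF inv(2), of k] by auto
  qed
  then show ?thesis
    by (auto simp: d_def)
qed

section \<open>A strict Poisson inequality\<close>

text \<open>A nonzero slope would give the value \<open>c + 1\<close> at
  \<open>t = (c + 1) / d\<close>. Scaling a test function by arbitrary \<open>t\<close> thereby
  turns an inequality into an invariance equation.\<close>

lemma bounded_line_slope_zero:
  fixes c d :: real
  assumes "\<And>t. t * d \<le> c"
  shows "d = 0"
  using assms[of "(c + 1) / d"] by (cases "d = 0") auto

text \<open>Duality: if the inequality had no solution, a separating hyperplane would give an invariant
  distribution \<open>q\<close> with \<open>(\<Sum>i. q i * f i) \<ge> 0\<close>.\<close>

lemma strict_poisson_inequality: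
  fixes P :: "'s::finite \<Rightarrow> 's \<Rightarrow> real" and f :: "'s \<Rightarrow> real"
  assumes neg: "\<And>q. stationary_distribution P q \<Longrightarrow> (\<Sum>i\<in>UNIV. q i * f i) < 0"
  obtains h where "\<And>i. f i + (\<Sum>j\<in>UNIV. P i j * h j) - h i < 0"
proof -
  define L where "L h i = h i - (\<Sum>j\<in>UNIV. P i j * h j)" for h :: "'s \<Rightarrow> real" and i
  have L_lin: "L (\<lambda>i. a * h i + b * k i) i = a * L h i + b * L k i" for a b h k i
    by (simp add: L_def algebra_simps sum.distrib sum_distrib_left)
  \<comment> \<open>A solution \<open>h\<close> exists exactly when 0 lies in
    \<open>K\<close>.\<close>
  define K where "K = {v :: real^'s. \<exists>h. \<forall>i. v $ i < L h i - f i}"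
  have "convex K"
    unfolding convex_def
  proof (intro ballI allI impI)
    fix v w :: "real^'s" and a b :: real
    assume "v \<in> K" "w \<in> K" and ab: "0 \<le> a" "0 \<le> b" "a + b = 1"
    then obtain h k where hk: "\<And>i. v $ i < L h i - f i" "\<And>i. w $ i < L k i - f i"
      by (auto simp: K_def)
    have "a * v $ i + b * w $ i < L (\<lambda>i. a * h i + b * k i) i - f i" for i
    proof -
      have "a * v $ i + b * w $ i < a * (L h i - f i) + b * (L k i - f i)"
      \<comment> \<open>Strictness needs a positive weight: \<open>a\<close> itself, or
        \<open>b = 1\<close> when \<open>a = 0\<close>.\<close>
      proof (cases "a = 0")
        case True
        then show ?thesis using ab hk by simp
      next
        case False
        then show ?thesis
          using ab hk[of i] by (intro add_less_le_mono mult_strict_left_mono mult_left_mono) auto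
      qed
      also have "\<dots> = L (\<lambda>i. a * h i + b * k i) i - (a + b) * f i"
        by (simp add: L_lin algebra_simps)
      finally show ?thesis using ab by simp
    qed
    then show "a *\<^sub>R v + b *\<^sub>R w \<in> K"
      unfolding K_def by auto
  qed
  have "0 \<in> K"
  proof (rule ccontr)
    assume "0 \<notin> K"
    then obtain a where "a \<noteq> 0" and a: "\<And>v. v \<in> K \<Longrightarrow> 0 \<le> inner a v"
      using separating_hyperplane_set_0[OF \<open>convex K\<close>] by blast
    \<comment> \<open>\<open>K\<close> is closed downwards, which forces the coordinates of the
      normal \<open>a\<close> to be nonpositive; hence the sign change.\<close>
    define q where "q i = - a $ i" for i
    have q: "(\<Sum>i\<in>UNIV. q i * v i) \<le> 0" if "\<And>i. v i < L h i - f i" for v h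
    proof -
      have "(\<chi> i. v i) \<in> K"
        using that by (auto simp: K_def)
      from a[OF this] show ?thesis
        by (simp add: inner_vec_def q_def sum_negf)
    qed
    have q_nonneg: "q k \<ge> 0" for k
    proof (rule ccontr)
      assume *: "\<not> q k \<ge> 0"
      \<comment> \<open>The vector \<open>- f - 1\<close> lies in \<open>K\<close> via
        \<open>h = 0\<close>, and lowering coordinate \<open>k\<close> by \<open>t\<close> stays in
        \<open>K\<close>. With \<open>q k < 0\<close>, this \<open>t\<close> makes
        \<open>- q k * t\<close> exceed \<open>\<bar>S\<bar>\<close>.\<close>
      define S where "S = (\<Sum>i\<in>UNIV. q i * (- f i - 1))"
      define t where "t = \<bar>S / q k\<bar> + 1"
      have "t \<ge> 0" by (simp add: t_def)
      then have "(\<Sum>i\<in>UNIV. q i * (- f i - 1 - (if i = k then t else 0))) \<le> 0"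
        by (intro q[of _ "\<lambda>_. 0"]) (auto simp: L_def)
      also have "(\<Sum>i\<in>UNIV. q i * (- f i - 1 - (if i = k then t else 0))) = S - q k * t"
        unfolding S_def
          by (simp add: right_diff_distrib sum_subtractf if_distrib[of "\<lambda>x. _ * x"] cong: if_cong)
      finally have "S - q k * t \<le> 0" .
      moreover have "q k * t = - \<bar>S\<bar> + q k"
        using * by (simp add: t_def abs_divide right_diff_distrib)
      ultimately show False using * by linarith
    qed
    have q_le: "(\<Sum>i\<in>UNIV. q i * L h i) \<le> (\<Sum>i\<in>UNIV. q i * f i)" for h
    proof (rule field_le_epsilon)
      fix e :: real assume "e > 0"
      define Q where "Q = (\<Sum>i\<in>UNIV. q i)"
      have "Q \<ge> 0" unfolding Q_def by (intro sum_nonneg q_nonneg)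
      \<comment> \<open>\<open>L h - f\<close> misses the strict inequality, so it is approached
        from below. The denominator is \<open>Q + 1\<close> because \<open>Q > 0\<close> is not yet
        known.\<close>
      have "(\<Sum>i\<in>UNIV. q i * (L h i - f i - e / (Q + 1))) \<le> 0"
        using \<open>e > 0\<close> \<open>Q \<ge> 0\<close> by (intro q[of _ h]) (auto intro!: divide_pos_pos)
      also have "(\<Sum>i\<in>UNIV. q i * (L h i - f i - e / (Q + 1)))
          = (\<Sum>i\<in>UNIV. q i * L h i) - (\<Sum>i\<in>UNIV. q i * f i) - Q * (e / (Q + 1))"
        unfolding Q_def by (simp only: right_diff_distrib sum_subtractf sum_distrib_right)
      finally have "(\<Sum>i\<in>UNIV. q i * L h i) \<le> (\<Sum>i\<in>UNIV. q i * f i) + Q * (e / (Q + 1))"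
        by simp
      also have "Q * (e / (Q + 1)) \<le> e"
        using \<open>e > 0\<close> \<open>Q \<ge> 0\<close> by (simp add: field_simps)
      finally show "(\<Sum>i\<in>UNIV. q i * L h i) \<le> (\<Sum>i\<in>UNIV. q i * f i) + e"
        by simp
    qed
    have inv: "(\<Sum>i\<in>UNIV. q i * P i j) = q j" for j
    proof -
      have "t * (q j - (\<Sum>i\<in>UNIV. q i * P i j)) \<le> (\<Sum>i\<in>UNIV. q i * f i)" for t
      proof -
        have "L (\<lambda>i. if i = j then t else 0) i = (if i = j then t else 0) - P i j * t" for i
          by (simp add: L_def if_distrib cong: if_cong)
        then have "(\<Sum>i\<in>UNIV. q i * L (\<lambda>i. if i = j then t else 0) i)
            = t * (q j - (\<Sum>i\<in>UNIV. q i * P i j))"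
          by (simp add: right_diff_distrib sum_subtractf sum_distrib_left mult_ac
                if_distrib[of "\<lambda>x. _ * x"] cong: if_cong)
        with q_le[of "\<lambda>i. if i = j then t else 0"] show ?thesis by simp
      qed
      from bounded_line_slope_zero[OF this] show ?thesis by simp
    qed
    have qf: "(\<Sum>i\<in>UNIV. q i * f i) \<ge> 0"
      using q_le[of "\<lambda>_. 0"] by (simp add: L_def)
    obtain k where "a $ k \<noteq> 0"
      using \<open>a \<noteq> 0\<close> by (auto simp: vec_eq_iff)
    then have "q k > 0"
      using q_nonneg[of k] by (simp add: q_def)
    define Q where "Q = (\<Sum>i\<in>UNIV. q i)"
    have "Q > 0"
      unfolding Q_def using \<open>q k > 0\<close> q_nonneg by (intro sum_pos2[of _ k]) auto
    have "stationary_distribution P (\<lambda>i. q i / Q)"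
      using \<open>Q > 0\<close> q_nonneg inv
      by (auto simp: stationary_distribution_def Q_def simp flip: sum_divide_distrib)
    from neg[OF this] have "(\<Sum>i\<in>UNIV. q i * f i) / Q < 0"
      by (simp add: sum_divide_distrib)
    with qf \<open>Q > 0\<close> show False
      by (simp add: divide_less_0_iff)
  qed
  then obtain h where "\<And>i. 0 < L h i - f i"
    by (auto simp: K_def)
  then show ?thesis
    by (intro that[of h]) (simp add: L_def algebra_simps)
qed

text \<open>At \<open>\<theta> = 0\<close> the sum is \<open>1\<close> and its derivative is the left-hand side of \<open>neg\<close>.\<close>

lemma exponential_contraction:
  fixes P c :: "'s::finite \<Rightarrow> 's \<Rightarrow> real"
  assumes P: "stochastic P"
    and neg: "\<And>i. (\<Sum>j\<in>UNIV. P i j * c i j) < 0"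
  obtains \<theta> r where "\<theta> > 0" "0 \<le> r" "r < 1" "\<And>i. (\<Sum>j\<in>UNIV. P i j * exp (\<theta> * c i j)) \<le> r"
proof -
  define \<phi> where "\<phi> i \<theta> = (\<Sum>j\<in>UNIV. P i j * exp (\<theta> * c i j))" for i and \<theta> :: real
  have \<phi>0: "\<phi> i 0 = 1" for i
    using P by (simp add: \<phi>_def stochastic_def)
  have "\<forall>\<^sub>F \<theta> in at_right 0. \<phi> i \<theta> < 1" for i
  proof -
    have "(\<phi> i has_real_derivative (\<Sum>j\<in>UNIV. P i j * c i j)) (at 0)"
      unfolding \<phi>_def by (auto intro!: derivative_eq_intros sum.cong)
    from DERIV_neg_dec_right[OF this neg] show ?thesis
      by (auto simp: \<phi>0 eventually_at_right_field)
  qed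
  \<comment> \<open>Finiteness of the state set provides one \<theta> for all states, and then a
    maximum \<open>r\<close> below 1.\<close>
  then have "\<forall>\<^sub>F \<theta> in at_right 0. \<forall>i\<in>UNIV. \<phi> i \<theta> < 1"
    by (intro eventually_ball_finite) auto
  then have "\<forall>\<^sub>F \<theta>::real in at_right 0. \<theta> > 0 \<and> (\<forall>i. \<phi> i \<theta> < 1)"
    using eventually_at_right_less[of "0::real"] by eventually_elim auto
  then obtain \<theta> where \<theta>: "\<theta> > 0" "\<And>i. \<phi> i \<theta> < 1"
    using eventually_happens'[OF trivial_limit_at_right_real] by blast
  define r where "r = Max (range (\<lambda>i. \<phi> i \<theta>))"
  have le: "\<phi> i \<theta> \<le> r" for i
    unfolding r_def by (intro Max_ge) auto
  have "r < 1"
    unfolding r_def using \<theta> by (subst Max_less_iff) auto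
  moreover have "0 \<le> \<phi> undefined \<theta>"
    unfolding \<phi>_def using P by (intro sum_nonneg) (simp add: stochastic_def)
  then have "0 \<le> r"
    using le[of undefined] by linarith
  ultimately show ?thesis
    using that \<theta> le unfolding \<phi>_def by blast
qed

section \<open>Almost sure decay along a Markov chain\<close>

text \<open>The Markov property is only given on complete histories. There are finitely many up to
  time \<open>n\<close>, and \<open>G\<close> is constant on each, so both expectations are finite
  sums over histories.\<close>

lemma markov_chain_expectation_step:
  fixes X :: "nat \<Rightarrow> 'w \<Rightarrow> 's::finite" and G :: "(nat \<Rightarrow> 's) \<Rightarrow> real"
  assumes "markov_chain W X s0 P"
    and G: "\<And>x y. (\<And>k. k \<le> n \<Longrightarrow> x k = y k) \<Longrightarrow> G x = G y"
  shows "integrable W (\<lambda>w. G (\<lambda>k. X k w) * g (X n w) (X (Suc n) w))"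
    and "(\<integral>w. G (\<lambda>k. X k w) * g (X n w) (X (Suc n) w) \<partial>W)
       = (\<integral>w. G (\<lambda>k. X k w) * (\<Sum>j\<in>UNIV. P (X n w) j * g (X n w) j) \<partial>W)"
proof -
  interpret prob_space W
    using assms by (simp add: markov_chain_def)
  have X[measurable]: "X k \<in> measurable W (count_space UNIV)" for k
    using assms by (simp add: markov_chain_def)
  have markov: "\<P>(w in W. X (Suc n) w = j \<bar> \<forall>k\<le>n. X k w = i k) = P (i n) j"
    if "\<P>(w in W. \<forall>k\<le>n. X k w = i k) > 0" for i j
    using assms that by (simp add: markov_chain_def)
  define I where "I = PiE {..n} (\<lambda>_. UNIV :: 's set)"
  have "finite I"
    unfolding I_def by (intro finite_PiE) auto
  define E where "E i = {w \<in> space W. \<forall>k\<le>n. X k w = i k}" for i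
  define E' where "E' i j = {w \<in> space W. X (Suc n) w = j \<and> (\<forall>k\<le>n. X k w = i k)}" for i j
  have [measurable]: "E i \<in> sets W" "E' i j \<in> sets W" for i j
    unfolding E_def E'_def by measurable
  have prob_E': "prob (E' i j) = prob (E i) * P (i n) j" for i j
  proof (cases "prob (E i) > 0")
    case True
    with markov[of i j] show ?thesis
      by (simp add: cond_prob_def E_def E'_def field_simps)
  next
    \<comment> \<open>On null histories the Markov property says nothing, but both sides are
      0.\<close>
    case False
    then have "prob (E i) = 0"
      using measure_nonneg[of W "E i"] by linarith
    moreover have "prob (E' i j) \<le> prob (E i)"
      by (intro finite_measure_mono) (auto simp: E_def E'_def)
    ultimately show ?thesis
      using measure_nonneg[of W "E' i j"] by simp
  qed
  have path: "restrict (\<lambda>k. X k w) {..n} \<in> I" for w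
    by (auto simp: I_def)
  have ind: "indicator (E i) w = (if i = restrict (\<lambda>k. X k w) {..n} then 1 else 0 :: real)"
    if "w \<in> space W" "i \<in> I" for i w
    using that by (auto simp: E_def I_def indicator_def restrict_def PiE_iff extensional_def fun_eq_iff)
  have ind': "indicator (E' i j) w = (indicator (E i) w * (if j = X (Suc n) w then 1 else 0) :: real)"
    for i j w
    by (auto simp: E_def E'_def indicator_def)
  have G': "G (restrict (\<lambda>k. X k w) {..n}) = G (\<lambda>k. X k w)" for w
    by (rule G) auto
  have eq: "G (\<lambda>k. X k w) * g (X n w) (X (Suc n) w)
      = (\<Sum>i\<in>I. \<Sum>j\<in>UNIV. G i * g (i n) j * indicator (E' i j) w)" if "w \<in> space W" for w
    using that \<open>finite I\<close> path
    by (simp add: ind' ind G' if_distrib[of "\<lambda>x. _ * x"] cong: if_cong sum.cong)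
  have eq': "G (\<lambda>k. X k w) * (\<Sum>j\<in>UNIV. P (X n w) j * g (X n w) j)
      = (\<Sum>i\<in>I. G i * (\<Sum>j\<in>UNIV. P (i n) j * g (i n) j) * indicator (E i) w)"
    if "w \<in> space W" for w
    using that \<open>finite I\<close> path
    by (simp add: ind G' if_distrib[of "\<lambda>x. _ * x"] cong: if_cong sum.cong)
  have "has_bochner_integral W (\<lambda>w. \<Sum>i\<in>I. \<Sum>j\<in>UNIV. G i * g (i n) j * indicator (E' i j) w)
      (\<Sum>i\<in>I. \<Sum>j\<in>UNIV. G i * g (i n) j * prob (E' i j))"
    by (intro has_bochner_integral_sum has_bochner_integral_mult_right
        has_bochner_integral_real_indicator) (auto simp: less_top[symmetric])
  then have lhs: "has_bochner_integral W (\<lambda>w. G (\<lambda>k. X k w) * g (X n w) (X (Suc n) w))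
      (\<Sum>i\<in>I. \<Sum>j\<in>UNIV. G i * g (i n) j * prob (E' i j))"
    by (rule has_bochner_integral_cong[THEN iffD1, rotated 3]) (simp_all add: eq)
  then show "integrable W (\<lambda>w. G (\<lambda>k. X k w) * g (X n w) (X (Suc n) w))"
    by (rule integrable.intros)
  have "has_bochner_integral W
      (\<lambda>w. \<Sum>i\<in>I. G i * (\<Sum>j\<in>UNIV. P (i n) j * g (i n) j) * indicator (E i) w)
      (\<Sum>i\<in>I. G i * (\<Sum>j\<in>UNIV. P (i n) j * g (i n) j) * prob (E i))"
    by (intro has_bochner_integral_sum has_bochner_integral_mult_right
        has_bochner_integral_real_indicator) (auto simp: less_top[symmetric])
  then have rhs: "has_bochner_integral W
      (\<lambda>w. G (\<lambda>k. X k w) * (\<Sum>j\<in>UNIV. P (X n w) j * g (X n w) j))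
      (\<Sum>i\<in>I. G i * (\<Sum>j\<in>UNIV. P (i n) j * g (i n) j) * prob (E i))"
    by (rule has_bochner_integral_cong[THEN iffD1, rotated 3]) (simp_all add: eq')
  have "(\<integral>w. G (\<lambda>k. X k w) * g (X n w) (X (Suc n) w) \<partial>W)
      = (\<Sum>i\<in>I. \<Sum>j\<in>UNIV. G i * g (i n) j * prob (E' i j))"
    using lhs by (rule has_bochner_integral_integral_eq)
  also have "\<dots> = (\<Sum>i\<in>I. G i * (\<Sum>j\<in>UNIV. P (i n) j * g (i n) j) * prob (E i))"
    by (simp add: prob_E' sum_distrib_left sum_distrib_right mult_ac)
  also have "\<dots> = (\<integral>w. G (\<lambda>k. X k w) * (\<Sum>j\<in>UNIV. P (X n w) j * g (X n w) j) \<partial>W)"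
    using rhs by (rule has_bochner_integral_integral_eq[symmetric])
  finally show "(\<integral>w. G (\<lambda>k. X k w) * g (X n w) (X (Suc n) w) \<partial>W)
       = (\<integral>w. G (\<lambda>k. X k w) * (\<Sum>j\<in>UNIV. P (X n w) j * g (X n w) j) \<partial>W)" .
qed

text \<open>The expectations are summable by the ratio test. Exchanging sum and integral makes the
  series of the \<open>Y n\<close> almost surely finite, so its terms tend to 0.\<close>

lemma AE_tendsto_zero_of_geometric_expectation:
  fixes Y :: "nat \<Rightarrow> 'w \<Rightarrow> real"
  assumes int: "\<And>n. integrable W (Y n)" and nonneg: "\<And>n w. Y n w \<ge> 0"
    and step: "\<And>n. (\<integral>w. Y (Suc n) w \<partial>W) \<le> r * (\<integral>w. Y n w \<partial>W)"
    and r: "0 \<le> r" "r < 1"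
  shows "AE w in W. (\<lambda>n. Y n w) \<longlonglongrightarrow> 0"
proof -
  let ?E = "\<lambda>n. \<integral>w. Y n w \<partial>W"
  have [measurable]: "Y n \<in> borel_measurable W" for n
    using int by auto
  have E_nonneg: "?E n \<ge> 0" for n
    by (intro integral_nonneg_AE) (simp add: nonneg)
  have "summable ?E"
    using r(2)
  proof (rule summable_ratio_test)
    show "norm (?E (Suc n)) \<le> r * norm (?E n)" for n
      using step[of n] E_nonneg by simp
  qed
  have "(\<integral>\<^sup>+w. (\<Sum>n. ennreal (Y n w)) \<partial>W) = (\<Sum>n. \<integral>\<^sup>+w. ennreal (Y n w) \<partial>W)"
    by (intro nn_integral_suminf) auto
  also have "\<dots> = (\<Sum>n. ennreal (?E n))"
    using int nonneg by (intro suminf_cong nn_integral_eq_integral) auto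
  also have "\<dots> = ennreal (\<Sum>n. ?E n)"
    using \<open>summable ?E\<close> E_nonneg by (intro suminf_ennreal2)
  also have "\<dots> \<noteq> \<infinity>" by simp
  finally have "AE w in W. (\<Sum>n. ennreal (Y n w)) \<noteq> \<infinity>"
    by (intro nn_integral_PInf_AE) auto
  then show ?thesis
  proof eventually_elim
    case (elim w)
    then have "summable (\<lambda>n. Y n w)"
      using nonneg by (intro summable_suminf_not_top) auto
    then show ?case by (rule summable_LIMSEQ_zero)
  qed
qed

text \<open>Negative stationary mean still allows states with positive one-step mean. The corrector
  \<open>h\<close> makes the drift negative in every state; being bounded, it can be removed at the
  end.\<close>

lemma markov_chain_exp_sum_tendsto_zero:
  fixes P c :: "'s::finite \<Rightarrow> 's \<Rightarrow> real" and X :: "nat \<Rightarrow> 'w \<Rightarrow> 's"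
  assumes P: "stochastic P" "ergodic_unichain P" and p: "stationary_distribution P p"
    and neg: "(\<Sum>i\<in>UNIV. p i * (\<Sum>j\<in>UNIV. P i j * c i j)) < 0"
    and mc: "markov_chain W X s0 P"
  shows "AE w in W. (\<lambda>n. exp (\<Sum>k<n. c (X k w) (X (Suc k) w))) \<longlonglongrightarrow> 0"
proof -
  interpret prob_space W
    using mc by (simp add: markov_chain_def)
  have "(\<Sum>i\<in>UNIV. q i * (\<Sum>j\<in>UNIV. P i j * c i j)) < 0" if "stationary_distribution P q" for q
    using ergodic_unichain_stationary_unique[OF P p that] neg by simp
  from strict_poisson_inequality[OF this] obtain h
    where h: "\<And>i. (\<Sum>j\<in>UNIV. P i j * c i j) + (\<Sum>j\<in>UNIV. P i j * h j) - h i < 0"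
    by blast
  have "(\<Sum>j\<in>UNIV. P i j * (c i j + h j - h i)) < 0" for i
  proof -
    have "(\<Sum>j\<in>UNIV. P i j * (c i j + h j - h i))
        = (\<Sum>j\<in>UNIV. P i j * c i j) + (\<Sum>j\<in>UNIV. P i j * h j) - (\<Sum>j\<in>UNIV. P i j) * h i"
      by (simp only: distrib_left right_diff_distrib sum.distrib sum_subtractf sum_distrib_right)
    with h[of i] P show ?thesis by (simp add: stochastic_def)
  qed
  from exponential_contraction[OF P(1) this] obtain \<theta> r
    where \<theta>: "\<theta> > 0" and r: "0 \<le> r" "r < 1"
      and contr: "\<And>i. (\<Sum>j\<in>UNIV. P i j * exp (\<theta> * (c i j + h j - h i))) \<le> r"
    by blast
  define S where "S n x = (\<Sum>k<n. c (x k) (x (Suc k)))" for n and x :: "nat \<Rightarrow> 's"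
  define G where "G n x = exp (\<theta> * (S n x + h (x n)))" for n and x :: "nat \<Rightarrow> 's"
  have G_cong: "G n x = G n y" if "\<And>k. k \<le> n \<Longrightarrow> x k = y k" for n x y
    unfolding G_def S_def using that by (auto intro!: sum.cong arg_cong2[where f = c])
  have G_Suc: "G (Suc n) x = G n x * exp (\<theta> * (c (x n) (x (Suc n)) + h (x (Suc n)) - h (x n)))"
    for n x
    by (simp add: G_def S_def algebra_simps flip: exp_add)
  have int: "integrable W (\<lambda>w. G n (\<lambda>k. X k w))" for n
    using markov_chain_expectation_step(1)[where G = "G n" and n = n, OF mc G_cong, where g = "\<lambda>_ _. 1"] by simp
  have "AE w in W. (\<lambda>n. G n (\<lambda>k. X k w)) \<longlonglongrightarrow> 0"
  proof (rule AE_tendsto_zero_of_geometric_expectation[OF int _ _ r])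
    show "0 \<le> G n (\<lambda>k. X k w)" for n w
      by (simp add: G_def)
    show "(\<integral>w. G (Suc n) (\<lambda>k. X k w) \<partial>W) \<le> r * (\<integral>w. G n (\<lambda>k. X k w) \<partial>W)" for n
    proof -
      let ?g = "\<lambda>i j. exp (\<theta> * (c i j + h j - h i))"
      have "(\<integral>w. G (Suc n) (\<lambda>k. X k w) \<partial>W)
          = (\<integral>w. G n (\<lambda>k. X k w) * (\<Sum>j\<in>UNIV. P (X n w) j * ?g (X n w) j) \<partial>W)"
        unfolding G_Suc by (rule markov_chain_expectation_step(2)[where G = "G n" and n = n, OF mc G_cong])
      also have "\<dots> \<le> (\<integral>w. G n (\<lambda>k. X k w) * r \<partial>W)"
      proof (rule integral_mono)
        \<comment> \<open>The conditional mean depends on \<open>X n\<close> alone, so it is a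
          \<open>g\<close> that ignores its second argument.\<close>
        show "integrable W (\<lambda>w. G n (\<lambda>k. X k w) * (\<Sum>j\<in>UNIV. P (X n w) j * ?g (X n w) j))"
          using markov_chain_expectation_step(1)
            [where G = "G n" and n = n, OF mc G_cong, where g = "\<lambda>i _. \<Sum>j\<in>UNIV. P i j * ?g i j"] .
        show "integrable W (\<lambda>w. G n (\<lambda>k. X k w) * r)"
          using int by simp
        show "G n (\<lambda>k. X k w) * (\<Sum>j\<in>UNIV. P (X n w) j * ?g (X n w) j) \<le> G n (\<lambda>k. X k w) * r"
          for w
          by (intro mult_left_mono contr) (simp add: G_def)
      qed
      finally show ?thesis by (simp add: mult.commute)
    qed
  qed
  then show ?thesis
  proof eventually_elim
    case (elim w)
    \<comment> \<open>The power \<open>1 / \<theta>\<close> undoes the scaling, and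
      \<open>exp (- m)\<close> compensates for \<open>exp (h (X n w))\<close>, which is at least
      \<open>exp m\<close>.\<close>
    define m where "m = Min (range h)"
    have m: "m \<le> h i" for i
      unfolding m_def by (intro Min_le) auto
    have "(\<lambda>n. (G n (\<lambda>k. X k w)) powr (1 / \<theta>) * exp (- m)) \<longlonglongrightarrow> 0"
      using elim \<theta> by (intro tendsto_mult_left_zero tendsto_zero_powrI[where b = "1 / \<theta>"])
        (auto simp: G_def)
    then show ?case
    proof (rule Lim_null_comparison[rotated], intro always_eventually allI)
      show "norm (exp (\<Sum>k<n. c (X k w) (X (Suc k) w)))
          \<le> (G n (\<lambda>k. X k w)) powr (1 / \<theta>) * exp (- m)" for n
        using \<theta> m[of "X n w"] by (simp add: G_def S_def powr_def flip: exp_add)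
    qed
  qed
qed

section \<open>Lyapunov functions\<close>

text \<open>Radial unboundedness controls large \<open>x\<close>, a minimum over a compact shell
  controls the rest, and finitely many modes make the bound uniform.\<close>

lemma lyapunov_candidate_bounded_below:
  fixes V :: "'s::finite \<Rightarrow> real^'n \<Rightarrow> real"
  assumes V: "lyapunov_candidate V" and "e > 0"
  obtains d where "d > 0" "\<And>s x. norm x \<ge> e \<Longrightarrow> V s x \<ge> d"
proof -
  have "\<exists>d>0. \<forall>x. norm x \<ge> e \<longrightarrow> V s x \<ge> d" for s
  proof -
    have cont: "continuous_on UNIV (V s)" and pos: "\<And>x. x \<noteq> 0 \<Longrightarrow> V s x > 0"
      and "filterlim (V s) at_top at_infinity"
      using V by (auto simp: lyapunov_candidate_def)
    then have "eventually (\<lambda>x. V s x \<ge> 1) at_infinity"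
      by (simp add: filterlim_at_top)
    then obtain b where b: "\<And>x. norm x \<ge> b \<Longrightarrow> V s x \<ge> 1"
      by (auto simp: eventually_at_infinity)
    define K where "K = cball 0 b - ball (0::real^'n) e"
    have "compact K"
      unfolding K_def by (intro compact_diff) auto
    show ?thesis
    proof (cases "K = {}")
      case True
      have "V s x \<ge> 1" if "norm x \<ge> e" for x
      proof -
        have "x \<notin> K" using True by simp
        then show ?thesis
          using that b[of x] by (auto simp: K_def not_less not_le)
      qed
      then show ?thesis by (intro exI[of _ 1]) auto
    next
      case False
      then obtain y where y: "y \<in> K" "\<And>x. x \<in> K \<Longrightarrow> V s y \<le> V s x"
        using continuous_attains_inf[OF \<open>compact K\<close> False, of "V s"]
          continuous_on_subset[OF cont] by auto
      have "y \<noteq> 0"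
        using y(1) \<open>e > 0\<close> by (auto simp: K_def)
      then have "V s y > 0" by (rule pos)
      moreover have "min (V s y) 1 \<le> V s x" if "norm x \<ge> e" for x
        using that b[of x] y(2)[of x] by (cases "norm x \<ge> b") (auto simp: K_def min_le_iff_disj)
      ultimately show ?thesis by (intro exI[of _ "min (V s y) 1"]) auto
    qed
  qed
  then obtain d where d: "\<And>s. d s > 0" "\<And>s x. norm x \<ge> e \<Longrightarrow> V s x \<ge> d s"
    by metis
  have "Min (range d) > 0"
    using d by simp
  moreover have "Min (range d) \<le> V s x" if "norm x \<ge> e" for s x
    using d(2)[OF that, of s] by (meson Min_le finite finite_imageI order_trans rangeI)
  ultimately show ?thesis
    using that by blast
qed

text \<open>The mode changes with \<open>k\<close>, so the lower bound away from 0 has to be uniform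
  over modes.\<close>

lemma lyapunov_candidate_tendsto_zero:
  fixes s :: "nat \<Rightarrow> 's::finite"
  assumes V: "lyapunov_candidate V" and lim: "(\<lambda>k. V (s k) (x k)) \<longlonglongrightarrow> 0"
  shows "x \<longlonglongrightarrow> 0"
proof (rule tendstoI)
  fix e :: real assume "e > 0"
  then obtain d where d: "d > 0" "\<And>s x. norm x \<ge> e \<Longrightarrow> V s x \<ge> d"
    using lyapunov_candidate_bounded_below[OF V] by blast
  have "eventually (\<lambda>k. V (s k) (x k) < d) sequentially"
    using lim \<open>d > 0\<close> by (rule order_tendstoD)
  then show "eventually (\<lambda>k. dist (x k) 0 < e) sequentially"
  proof eventually_elim
    case (elim k)
    then show ?case using d(2)[of "x k" "s k"] by force
  qed
qed

text \<open>Each step first contracts the function of the current mode by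
  \<open>1 - \<alpha>\<close>, then passes to that of the next mode, at the cost of \<mu> only if
  the mode really changes.\<close>

lemma lyapunov_trajectory_bound:
  fixes s :: "nat \<Rightarrow> 's" and V :: "'s \<Rightarrow> real^'n \<Rightarrow> real" and \<alpha> \<mu> :: real
  defines "c \<equiv> \<lambda>i j. ln (1 - \<alpha>) + (if i = j then 0 else ln \<mu>)"
  assumes "\<alpha> < 1" "\<mu> > 1"
    and dec: "\<And>s x. V s (A s *v x) - V s x \<le> - \<alpha> * V s x"
    and switch: "\<And>s s' x. V s x \<le> \<mu> * V s' x"
  shows "V (s k) (trajectory A s x0 k)
    \<le> exp (\<Sum>i<k. c (s i) (s (Suc i))) * V (s 0) x0"
proof (induction k)
  case (Suc k)
  let ?x = "trajectory A s x0 k" and ?m = "if s k = s (Suc k) then 1 else \<mu>"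
  have "V (s (Suc k)) (A (s k) *v ?x) \<le> ?m * V (s k) (A (s k) *v ?x)"
    using switch by auto
  also have "V (s k) (A (s k) *v ?x) \<le> (1 - \<alpha>) * V (s k) ?x"
    using dec[of "s k" ?x] by (simp add: algebra_simps)
  also have "V (s k) ?x \<le> exp (\<Sum>i<k. c (s i) (s (Suc i))) * V (s 0) x0"
    by (rule Suc)
  also have "?m * ((1 - \<alpha>) * (exp (\<Sum>i<k. c (s i) (s (Suc i))) * V (s 0) x0))
      = exp (\<Sum>i<Suc k. c (s i) (s (Suc i))) * V (s 0) x0"
    using assms by (simp add: c_def exp_add)
  finally show ?case
    using assms by (simp add: mult_left_mono)
qed simp

theorem theorem4:
  fixes M :: "('s::finite, 'a::finite) mdp"
    and A :: "'s \<Rightarrow> real^'n^'n"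
    and V :: "'s \<Rightarrow> real^'n \<Rightarrow> real"
    and \<alpha> \<mu> :: real
    and \<pi> :: "'s \<Rightarrow> 'a \<Rightarrow> real"
    and p :: "'s \<Rightarrow> real"
    and W :: "'w measure"
    and X :: "nat \<Rightarrow> 'w \<Rightarrow> 's"
  assumes "ergodic_unichain_mdp M"
    and "0 < \<alpha>" and "\<alpha> < 1" and "\<mu> > 1"
    and "lyapunov_candidate V"
    and "\<And>s x. V s (A s *v x) - V s x \<le> - \<alpha> * V s x"
    and "\<And>s s' x. V s x \<le> \<mu> * V s' x"
    and "is_policy M \<pi>"
    and "stationary_distribution (induced M \<pi>) p"
    and "jump_probability (induced M \<pi>) p < ln (1 / (1 - \<alpha>)) / ln \<mu>"
    and "markov_chain W X (init M) (induced M \<pi>)"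
  shows "stable_with_probability_one W X A"
proof -
  define P where "P = induced M \<pi>"
  define c where "c i j = ln (1 - \<alpha>) + (if i = j then 0 else ln \<mu>)" for i j :: 's
  have P: "stochastic P" "ergodic_unichain P"
    using assms stochastic_induced by (auto simp: ergodic_unichain_mdp_def P_def)
  have p: "stationary_distribution P p" and jump: "jump_probability P p * ln \<mu> < - ln (1 - \<alpha>)"
    using assms by (auto simp: P_def field_simps ln_div)
  \<comment> \<open>From state \<open>i\<close> the jump cost \<open>ln \<mu>\<close> is paid with
    probability \<open>1 - P i i\<close>; averaging over \<open>p\<close> produces the jump
    probability.\<close>
  have "(\<Sum>j\<in>UNIV. P i j * c i j) = ln (1 - \<alpha>) + ln \<mu> - P i i * ln \<mu>" for i
  proof -
    have "P i j * c i j = P i j * (ln (1 - \<alpha>) + ln \<mu>) - (if i = j then P i j * ln \<mu> else 0)" for j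
      by (simp add: c_def algebra_simps)
    then show ?thesis
      using P by (simp add: sum_subtractf stochastic_def flip: sum_distrib_right)
  qed
  then have "(\<Sum>i\<in>UNIV. p i * (\<Sum>j\<in>UNIV. P i j * c i j))
      = (\<Sum>i\<in>UNIV. p i) * (ln (1 - \<alpha>) + ln \<mu>) - (\<Sum>i\<in>UNIV. p i * P i i) * ln \<mu>"
    by (simp add: right_diff_distrib sum_subtractf sum_distrib_right mult.assoc)
  also have "\<dots> = ln (1 - \<alpha>) + jump_probability P p * ln \<mu>"
    using p by (simp add: stationary_distribution_def jump_probability_def algebra_simps)
  also have "\<dots> < 0"
    using jump by simp
  finally have "AE w in W. (\<lambda>n. exp (\<Sum>k<n. c (X k w) (X (Suc k) w))) \<longlonglongrightarrow> 0"
    using assms(11) by (intro markov_chain_exp_sum_tendsto_zero[OF P p]) (simp_all add: P_def)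
  then have "AE w in W. (\<lambda>k. infnorm (trajectory A (\<lambda>j. X j w) x0 k)) \<longlonglongrightarrow> 0" for x0
  proof eventually_elim
    case (elim w)
    let ?x = "trajectory A (\<lambda>j. X j w) x0"
    have V_nonneg: "V s x \<ge> 0" for s x
      using assms(5) by (cases "x = 0") (auto simp: lyapunov_candidate_def intro: less_imp_le)
    have "(\<lambda>k. V (X k w) (?x k)) \<longlonglongrightarrow> 0"
    proof (rule Lim_null_comparison[OF always_eventually tendsto_mult_left_zero[OF elim]], rule allI)
      show "norm (V (X k w) (?x k))
          \<le> exp (\<Sum>i<k. c (X i w) (X (Suc i) w)) * V (X 0 w) x0" for k
        using lyapunov_trajectory_bound[where V = V, OF assms(3,4,6,7), of "\<lambda>j. X j w" k x0]
        by (simp add: V_nonneg c_def)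
    qed
    then have "?x \<longlonglongrightarrow> 0"
      by (rule lyapunov_candidate_tendsto_zero[OF assms(5)])
    from tendsto_infnorm[OF this] show ?case
      by (simp add: infnorm_0)
  qed
  then show ?thesis
    by (simp add: stable_with_probability_one_def)
qed

end
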